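(* Let $X$ and $Y$ be locally compact Hausdorff spaces, and for $Z\in\{X,Y\}$ let $H_Z$ be a Hausdorff space, $\theta_Z\colon Z\to H_Z$ a continuous map, and $\mathcal{A}(Z)\subseteq C_c(Z,\theta_Z)$ a subset containing $\theta_Z$. Suppose that $(X,\theta_X,\mathcal{A}(X))$ and $(Y,\theta_Y,\mathcal{A}(Y))$ are weakly regular and that $T\colon\mathcal{A}(X)\to\mathcal{A}(Y)$ is a $\perp\!\!\!\perp$-isomorphism. Then there is a unique homeomorphism $\phi\colon Y\to X$ such that $\phi(\operatorname{supp}(Tf))=\operatorname{supp}(f)$ for all $f\in\mathcal{A}(X)$ (equivalently, such that $\phi(\sigma(Tf))=\sigma(f)$ for all $f\in\mathcal{A}(X)$, or such that $\phi(Z(Tf))=Z(f)$ for all $f\in\mathcal{A}(X)$).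
   Context: For a locally compact Hausdorff space $X$, a Hausdorff space $H$ and a continuous map $\theta\colon X\to H$: for continuous $f\colon X\to H$ let $[f\neq\theta]=\{x\in X: f(x)\neq\theta(x)\}$, $\operatorname{supp}(f)=\overline{[f\neq\theta]}$, $\sigma(f)=\operatorname{int}(\operatorname{supp}(f))$ and $Z(f)=X\setminus\operatorname{supp}(f)$. $C_c(X,\theta)$ is the set of continuous $f\colon X\to H$ with $\operatorname{supp}(f)$ compact. (For functions on $Y$ these are taken with respect to $\theta_Y$.) Write $f\perp\!\!\!\perp g$ if $\operatorname{supp}(f)\cap\operatorname{supp}(g)=\varnothing$. A subset $\mathcal{A}\subseteq C_c(X,\theta)$ containing $\theta$ is weakly regular (also: $(X,\theta,\mathcal{A})$ is weakly regular) if $\{\sigma(f):f\in\mathcal{A}\}$ is a basis for the topology of $X$. A map $T\colon\mathcal{A}(X)\to\mathcal{A}(Y)$ is a $\perp\!\!\!\perp$-isomorphism if it is bijective and, for all $f,g\in\mathcal{A}(X)$, $f\perp\!\!\!\perp g$ if and only if $Tf\perp\!\!\!\perp Tg$. *)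

theory Defs
  imports "HOL-Analysis.Analysis"
begin

text \<open>Spaces are abstract topologies, so the empty space is allowed and a function on a space is
  represented by its extensional representative on \<open>topspace\<close>; equality of functions is then HOL
  equality.\<close>

definition supp :: "'a topology \<Rightarrow> ('a \<Rightarrow> 'h) \<Rightarrow> ('a \<Rightarrow> 'h) \<Rightarrow> 'a set" where
  "supp X \<theta> f = X closure_of {x \<in> topspace X. f x \<noteq> \<theta> x}"

definition int_supp :: "'a topology \<Rightarrow> ('a \<Rightarrow> 'h) \<Rightarrow> ('a \<Rightarrow> 'h) \<Rightarrow> 'a set" where
  "int_supp X \<theta> f = X interior_of (supp X \<theta> f)"

definition co_supp :: "'a topology \<Rightarrow> ('a \<Rightarrow> 'h) \<Rightarrow> ('a \<Rightarrow> 'h) \<Rightarrow> 'a set" where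
  "co_supp X \<theta> f = topspace X - supp X \<theta> f"

definition Cc :: "'a topology \<Rightarrow> 'h topology \<Rightarrow> ('a \<Rightarrow> 'h) \<Rightarrow> ('a \<Rightarrow> 'h) set" where
  "Cc X H \<theta> =
     {f \<in> extensional (topspace X). continuous_map X H f \<and> compactin X (supp X \<theta> f)}"

definition sdisjoint :: "'a topology \<Rightarrow> ('a \<Rightarrow> 'h) \<Rightarrow> ('a \<Rightarrow> 'h) \<Rightarrow> ('a \<Rightarrow> 'h) \<Rightarrow> bool" where
  "sdisjoint X \<theta> f g \<longleftrightarrow> supp X \<theta> f \<inter> supp X \<theta> g = {}"

text \<open>The equation below says that the sets \<open>int_supp X \<theta> f\<close>, for \<open>f \<in> A\<close>, form a basis
  of \<open>X\<close>: the open sets are exactly the unions of such sets (cf. \<open>openin_topology_base_unique\<close>).\<close>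

definition weakly_regular :: "'a topology \<Rightarrow> ('a \<Rightarrow> 'h) \<Rightarrow> ('a \<Rightarrow> 'h) set \<Rightarrow> bool" where
  "weakly_regular X \<theta> A \<longleftrightarrow>
     openin X = arbitrary union_of (\<lambda>U. U \<in> int_supp X \<theta> ` A)"

definition sdisjoint_iso ::
  "'a topology \<Rightarrow> ('a \<Rightarrow> 'h) \<Rightarrow> ('a \<Rightarrow> 'h) set \<Rightarrow>
   'b topology \<Rightarrow> ('b \<Rightarrow> 'k) \<Rightarrow> ('b \<Rightarrow> 'k) set \<Rightarrow>
   (('a \<Rightarrow> 'h) \<Rightarrow> ('b \<Rightarrow> 'k)) \<Rightarrow> bool" where
  "sdisjoint_iso X \<theta>X AX Y \<theta>Y AY T \<longleftrightarrow>
     bij_betw T AX AY \<and>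
     (\<forall>f\<in>AX. \<forall>g\<in>AX. sdisjoint X \<theta>X f g \<longleftrightarrow> sdisjoint Y \<theta>Y (T f) (T g))"

end

(* The points x of X and y of Y correspond when x lies in supp f for every f such that y is interior
   to supp (T f).  Since supports contain arbitrarily small neighbourhoods, disjointness of
   supports determines inclusion of supports, so for a given y these sets supp f have the finite
   intersection property and, being compact, a common point; it is unique because disjoint
   supports can separate points.  The correspondence is symmetric in X and Y, hence a bijection,
   and it matches supp (T f) with supp f.  It is continuous because on a compact support the
   topology is determined by the supports, as closed sets. *)
theory Submission
  imports Defs
begin

section \<open>Two families of compact sets with the same disjointness relation\<close>

locale support_pair =
  fixes X :: "'a topology" and Y :: "'b topology" and I :: "'i set"
    and K :: "'i \<Rightarrow> 'a set" and L :: "'i \<Rightarrow> 'b set"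
  assumes Hausdorff: "Hausdorff_space X" "Hausdorff_space Y"
    and compact: "\<And>f. f \<in> I \<Longrightarrow> compactin X (K f)" "\<And>f. f \<in> I \<Longrightarrow> compactin Y (L f)"
    and small_X: "\<And>U x. openin X U \<Longrightarrow> x \<in> U \<Longrightarrow> \<exists>f\<in>I. x \<in> X interior_of K f \<and> K f \<subseteq> U"
    and small_Y: "\<And>U y. openin Y U \<Longrightarrow> y \<in> U \<Longrightarrow> \<exists>f\<in>I. y \<in> Y interior_of L f \<and> L f \<subseteq> U"
    and disjoint_iff: "\<And>f g. f \<in> I \<Longrightarrow> g \<in> I \<Longrightarrow> K f \<inter> K g = {} \<longleftrightarrow> L f \<inter> L g = {}"
begin

text \<open>The locale forgets the functions and keeps only their supports, indexed by a common set.
  Its assumptions are symmetric in the two spaces, so every fact proved for \<open>X\<close> becomes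
  available for \<open>Y\<close>.\<close>

lemma support_pair_swap: "support_pair Y X I L K"
  by unfold_locales (use Hausdorff compact small_X small_Y disjoint_iff in auto)

lemma closed_X: "f \<in> I \<Longrightarrow> closedin X (K f)"
  using Hausdorff compact by (auto intro: compactin_imp_closedin)

lemma subset_topspace_X: "f \<in> I \<Longrightarrow> K f \<subseteq> topspace X"
  using compact compactin_subset_topspace by blast

lemma obtain_disjoint_X:
  assumes "f \<in> I" "x \<in> topspace X" "x \<notin> K f"
  obtains g where "g \<in> I" "x \<in> X interior_of K g" "x \<in> K g" "K g \<inter> K f = {}"
proof -
  have "openin X (topspace X - K f)" using closed_X assms by blast
  then obtain g where "g \<in> I" "x \<in> X interior_of K g" "K g \<subseteq> topspace X - K f"
    using small_X[of _ x] assms by blast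
  then show thesis using that interior_of_subset[of X "K g"] by blast
qed

section \<open>The correspondence between points\<close>

definition corr :: "'a \<Rightarrow> 'b \<Rightarrow> bool" where
  "corr x y \<longleftrightarrow> x \<in> topspace X \<and> y \<in> topspace Y \<and>
     (\<forall>f\<in>I. y \<in> Y interior_of L f \<longrightarrow> x \<in> K f)"

lemmas closed_Y = support_pair.closed_X[OF support_pair_swap]
lemmas subset_topspace_Y = support_pair.subset_topspace_X[OF support_pair_swap]
lemmas obtain_disjoint_Y = support_pair.obtain_disjoint_X[OF support_pair_swap]

text \<open>A point of \<open>K f\<close> outside \<open>K g\<close> would have a small
  \<open>K h\<close> around it that misses \<open>K g\<close> but meets \<open>K f\<close>. Then
  \<open>L h\<close> misses \<open>L g\<close>, hence also \<open>L f\<close>, which contradicts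
  \<open>disjoint_iff\<close> for \<open>h\<close> and \<open>f\<close>.\<close>

lemma subset_transfer:
  assumes "f \<in> I" "g \<in> I" "L f \<subseteq> L g"
  shows "K f \<subseteq> K g"
proof
  fix x assume x: "x \<in> K f"
  show "x \<in> K g"
  proof (rule ccontr)
    assume "x \<notin> K g"
    moreover have "x \<in> topspace X" using x subset_topspace_X assms by blast
    ultimately obtain h where "h \<in> I" "x \<in> K h" "K h \<inter> K g = {}"
      using obtain_disjoint_X assms(2) by metis
    then show False using disjoint_iff[of h g] disjoint_iff[of h f] assms x by blast
  qed
qed

text \<open>Asking for interior points in \<open>corr\<close> pays off here: finitely many of the
  interiors intersect in a neighbourhood of \<open>y\<close>, which contains a smaller set
  \<open>L h\<close>.\<close>

lemma corr_exists:
  assumes y: "y \<in> topspace Y"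
  shows "\<exists>x. corr x y"
proof -
  define J where "J = {f \<in> I. y \<in> Y interior_of L f}"
  have "J \<noteq> {}" using small_Y[of "topspace Y" y] y by (auto simp: J_def)
  \<comment> \<open>\<open>f0\<close> supplies a compact set \<open>K f0\<close> in which the finite
    intersection property can be applied.\<close>
  then obtain f0 where f0: "f0 \<in> J" by blast
  have fip: "K f0 \<inter> \<Inter>\<F> \<noteq> {}" if fin: "finite \<F>" and sub: "\<F> \<subseteq> K ` J" for \<F>
  proof -
    obtain F where F: "finite F" "F \<subseteq> J" "\<F> = K ` F"
      using finite_subset_image[OF fin sub] by blast
    define U where "U = (\<Inter>f\<in>insert f0 F. Y interior_of L f)"
    have "openin Y U" unfolding U_def using F by (intro openin_INT2) auto
    moreover have "y \<in> U" using F f0 by (auto simp: U_def J_def)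
    ultimately obtain h where h: "h \<in> I" "y \<in> Y interior_of L h" "L h \<subseteq> U"
      using small_Y by blast
    \<comment> \<open>A set is empty exactly when it is disjoint from itself, so
      \<open>disjoint_iff\<close> with \<open>h\<close> in both places carries nonemptiness from
      \<open>L h\<close> to \<open>K h\<close>.\<close>
    have "L h \<inter> L h \<noteq> {}" using h interior_of_subset[of Y "L h"] by blast
    then have "K h \<noteq> {}" using disjoint_iff[of h h] h by blast
    moreover have "K h \<subseteq> K f" if f: "f \<in> insert f0 F" for f
    proof (rule subset_transfer)
      show "L h \<subseteq> L f"
        using h f interior_of_subset[of Y "L f"] unfolding U_def by blast
    qed (use h f f0 F in \<open>auto simp: J_def\<close>)
    ultimately show ?thesis using F by blast
  qed
  have "K f0 \<inter> \<Inter>(K ` J) \<noteq> {}"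
  proof (rule compactin_fip[THEN iffD1, THEN conjunct2, rule_format])
    show "compactin X (K f0)" using f0 compact by (simp add: J_def)
  qed (use closed_X fip in \<open>auto simp: J_def\<close>)
  then obtain x where "x \<in> K f0" "\<And>f. f \<in> J \<Longrightarrow> x \<in> K f" by blast
  then show ?thesis using y f0 subset_topspace_X by (auto simp: corr_def J_def)
qed

text \<open>This is the defining condition of \<open>corr\<close> with the two spaces exchanged. If
  \<open>y\<close> were outside \<open>L g\<close>, some \<open>L f\<close> around \<open>y\<close>
  would miss \<open>L g\<close>; then \<open>x\<close> lies in \<open>K f\<close> by correspondence
  and in \<open>K g\<close>, although these are disjoint.\<close>

lemma corr_interior_mem:
  assumes corr: "corr x y" and g: "g \<in> I" "x \<in> X interior_of K g"
  shows "y \<in> L g"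
proof (rule ccontr)
  assume "y \<notin> L g"
  then obtain f where "f \<in> I" "y \<in> Y interior_of L f" "L f \<inter> L g = {}"
    using obtain_disjoint_Y g corr unfolding corr_def by metis
  moreover have "x \<in> K g" using g interior_of_subset[of X "K g"] by blast
  ultimately show False using disjoint_iff[of f g] g corr unfolding corr_def by blast
qed

lemma corr_swap: "corr x y \<Longrightarrow> support_pair.corr Y X I L K y x"
  using corr_interior_mem[of x y] unfolding support_pair.corr_def[OF support_pair_swap]
  by (simp add: corr_def[of x y])

text \<open>Otherwise disjoint \<open>K h\<close> and \<open>K h'\<close> around the two points
  would give disjoint \<open>L h\<close> and \<open>L h'\<close>, both containing
  \<open>y\<close>.\<close>

lemma corr_unique:
  assumes "corr x y" "corr x' y"
  shows "x = x'"
proof (rule ccontr)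
  assume "x \<noteq> x'"
  then obtain U V where U: "openin X U" "x \<in> U" and V: "openin X V" "x' \<in> V" and "disjnt U V"
    using Hausdorff(1) assms unfolding Hausdorff_space_def corr_def by metis
  obtain h where h: "h \<in> I" "x \<in> X interior_of K h" "K h \<subseteq> U" using small_X U by blast
  obtain h' where h': "h' \<in> I" "x' \<in> X interior_of K h'" "K h' \<subseteq> V" using small_X V by blast
  have "K h \<inter> K h' = {}" using h h' \<open>disjnt U V\<close> by (auto simp: disjnt_def)
  then have "y \<notin> L h \<or> y \<notin> L h'" using disjoint_iff h h' by blast
  then show False using corr_interior_mem h h' assms by blast
qed

text \<open>Improves the definition of \<open>corr\<close> from interior points of
  \<open>L f\<close> to all its points, boundary included; with its mirror image it shows that
  corresponding points lie in the same supports.\<close>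

lemma corr_mem_imp:
  assumes "corr x y" "f \<in> I" "y \<in> L f"
  shows "x \<in> K f"
proof (rule ccontr)
  assume "x \<notin> K f"
  then obtain g where "g \<in> I" "x \<in> X interior_of K g" "K g \<inter> K f = {}"
    using obtain_disjoint_X assms unfolding corr_def by metis
  moreover have "y \<in> L g" using corr_interior_mem assms(1) calculation by blast
  ultimately show False using disjoint_iff[of g f] assms by blast
qed

lemma corr_swap_iff: "support_pair.corr Y X I L K y x \<longleftrightarrow> corr x y"
  using corr_swap support_pair.corr_swap[OF support_pair_swap] by blast

lemma corr_mem_iff: "corr x y \<Longrightarrow> f \<in> I \<Longrightarrow> x \<in> K f \<longleftrightarrow> y \<in> L f"
  using corr_mem_imp support_pair.corr_mem_imp[OF support_pair_swap] corr_swap_iff by blast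

section \<open>Continuity and the homeomorphism\<close>

lemma corr_continuous:
  assumes corr: "\<And>y. y \<in> topspace Y \<Longrightarrow> corr (\<phi> y) y"
  shows "continuous_map Y X \<phi>"
  unfolding continuous_map_def
proof (intro conjI allI impI)
  show "\<phi> \<in> topspace Y \<rightarrow> topspace X" using corr by (auto simp: corr_def)
  fix U assume U: "openin X U"
  show "openin Y {y \<in> topspace Y. \<phi> y \<in> U}"
  proof (subst openin_subopen, safe)
    fix y assume y: "y \<in> topspace Y" "\<phi> y \<in> U"
    \<comment> \<open>On the neighbourhood \<open>L f\<close> of \<open>y\<close> the map takes
      values in the compact set \<open>K f\<close>, so only the part of \<open>K f\<close> outside
      \<open>U\<close> has to be avoided.\<close>
    obtain f where f: "f \<in> I" "y \<in> Y interior_of L f"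
      using small_Y[of "topspace Y" y] y by auto
    \<comment> \<open>Every point outside \<open>U\<close> differs from \<open>\<phi> y\<close>,
      hence is interior to some \<open>K g\<close> that omits \<open>\<phi> y\<close>; these
      interiors cover the compact part to be avoided.\<close>
    define C where "C = (\<lambda>g. X interior_of K g) ` {g \<in> I. \<phi> y \<notin> K g}"
    have "compactin X (K f \<inter> (topspace X - U))"
      using compact f U by (intro compact_Int_closedin) auto
    moreover have "K f \<inter> (topspace X - U) \<subseteq> \<Union>C"
    proof
      fix z assume z: "z \<in> K f \<inter> (topspace X - U)"
      have "openin X (topspace X - {\<phi> y})"
        using Hausdorff(1) y corr
        by (intro openin_diff closedin_Hausdorff_singleton) (auto simp: corr_def)
      then show "z \<in> \<Union>C" using small_X[of _ z] z y unfolding C_def by blast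
    qed
    ultimately obtain D where D: "finite D" "D \<subseteq> C" "K f \<inter> (topspace X - U) \<subseteq> \<Union>D"
      using compactinD[of X "K f \<inter> (topspace X - U)" C] unfolding C_def
      by (metis (no_types, lifting) imageE openin_interior_of)
    obtain G where G: "G \<subseteq> {g \<in> I. \<phi> y \<notin> K g}" "finite G"
      "D = (\<lambda>g. X interior_of K g) ` G"
      using finite_subset_image[OF D(1) D(2)[unfolded C_def]] by blast
    \<comment> \<open>Each removed \<open>L g\<close> is closed and omits \<open>y\<close> because
      \<open>K g\<close> omits \<open>\<phi> y\<close>. A point of \<open>W\<close> is sent into
      \<open>K f\<close> but outside the finite cover, hence into \<open>U\<close>.\<close>
    define W where "W = Y interior_of L f - \<Union>(L ` G)"
    have "openin Y W" unfolding W_def using G closed_Y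
      by (intro openin_diff closedin_Union) auto
    moreover have "y \<in> W" using f G corr_mem_iff[OF corr] y by (auto simp: W_def)
    moreover have "W \<subseteq> {y \<in> topspace Y. \<phi> y \<in> U}"
    proof
      fix w assume w: "w \<in> W"
      then have wL: "w \<in> L f" using interior_of_subset[of Y "L f"] by (auto simp: W_def)
      then have wY: "w \<in> topspace Y" using subset_topspace_Y f by blast
      have "\<phi> w \<in> K f" using corr_mem_iff[OF corr] wL wY f by blast
      moreover have "\<phi> w \<notin> \<Union>D"
      proof
        assume "\<phi> w \<in> \<Union>D"
        then obtain g where "g \<in> G" "\<phi> w \<in> K g"
          using G interior_of_subset by fastforce
        then show False using corr_mem_iff[OF corr[OF wY]] w G by (auto simp: W_def)
      qed
      ultimately show "w \<in> {y \<in> topspace Y. \<phi> y \<in> U}"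
        using D wY corr[OF wY] by (auto simp: corr_def)
    qed
    ultimately show "\<exists>T. openin Y T \<and> y \<in> T \<and> T \<subseteq> {y \<in> topspace Y. \<phi> y \<in> U}" by blast
  qed
qed

theorem ex1_homeomorphic_map:
  "\<exists>!\<phi>. \<phi> \<in> extensional (topspace Y) \<and> homeomorphic_map Y X \<phi> \<and> (\<forall>f\<in>I. \<phi> ` L f = K f)"
proof -
  interpret swap: support_pair Y X I L K by (rule support_pair_swap)
  obtain \<phi>0 where \<phi>0: "\<And>y. y \<in> topspace Y \<Longrightarrow> corr (\<phi>0 y) y" using corr_exists by metis
  \<comment> \<open>Restriction selects the extensional representative, so that uniqueness can be
    stated as equality.\<close>
  define \<phi> where "\<phi> = restrict \<phi>0 (topspace Y)"
  have \<phi>: "corr (\<phi> y) y" if "y \<in> topspace Y" for y using \<phi>0 that by (simp add: \<phi>_def)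
  obtain \<psi> where \<psi>: "\<And>x. x \<in> topspace X \<Longrightarrow> swap.corr (\<psi> x) x" using swap.corr_exists by metis
  have \<psi>': "corr x (\<psi> x)" if "x \<in> topspace X" for x using \<psi> that corr_swap_iff by blast
  have \<phi>\<psi>: "\<phi> (\<psi> x) = x" if "x \<in> topspace X" for x
    using corr_unique[OF \<phi> \<psi>'] \<psi>' that by (auto simp: corr_def)
  have \<psi>\<phi>: "\<psi> (\<phi> y) = y" if "y \<in> topspace Y" for y
    using swap.corr_unique[OF \<psi>, of "\<phi> y" y] \<phi> corr_swap_iff that by (auto simp: corr_def)
  have "continuous_map Y X \<phi>" "continuous_map X Y \<psi>"
    using corr_continuous \<phi> swap.corr_continuous \<psi> by blast+
  then have "homeomorphic_map Y X \<phi>"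
    using \<phi>\<psi> \<psi>\<phi> by (auto simp: homeomorphic_map_maps homeomorphic_maps_def)
  moreover have "\<phi> ` L f = K f" if f: "f \<in> I" for f
  proof
    show "\<phi> ` L f \<subseteq> K f" using corr_mem_iff[OF \<phi>] f subset_topspace_Y by blast
    show "K f \<subseteq> \<phi> ` L f"
    proof
      fix x assume x: "x \<in> K f"
      then have "x \<in> topspace X" using f subset_topspace_X by blast
      then show "x \<in> \<phi> ` L f" using corr_mem_iff[OF \<psi>'] \<phi>\<psi> f x by force
    qed
  qed
  moreover have "\<phi> \<in> extensional (topspace Y)" by (simp add: \<phi>_def)
  moreover have "\<phi>' = \<phi>"
    if \<phi>': "\<phi>' \<in> extensional (topspace Y)" "homeomorphic_map Y X \<phi>'" "\<forall>f\<in>I. \<phi>' ` L f = K f" for \<phi>'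
  proof (rule extensionalityI)
    fix y assume y: "y \<in> topspace Y"
    have "\<phi>' y \<in> topspace X" using \<phi>' y homeomorphic_imp_surjective_map by blast
    \<comment> \<open>If \<open>y\<close> is interior to \<open>L f\<close>, it lies in
      \<open>L f\<close>, so its image lies in \<open>K f\<close>: any competing map must send
      \<open>y\<close> to a corresponding point.\<close>
    then have "corr (\<phi>' y) y" using \<phi>' y interior_of_subset unfolding corr_def by fast
    then show "\<phi>' y = \<phi> y" using corr_unique \<phi> y by blast
  qed (use \<phi>' \<open>\<phi> \<in> extensional (topspace Y)\<close> in auto)
  ultimately show ?thesis by (intro ex1I[where a = \<phi>] conjI ballI) (blast | metis)+
qed

end

section \<open>From functions to their supports\<close>

lemma openin_neq:
  assumes "Hausdorff_space H" "continuous_map X H \<theta>" "continuous_map X H f"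
  shows "openin X {x \<in> topspace X. f x \<noteq> \<theta> x}"
proof -
  have "closedin X {x \<in> topspace X. f x = \<theta> x}"
    using assms by (intro closedin_continuous_maps_eq) auto
  moreover have "{x \<in> topspace X. f x \<noteq> \<theta> x} = topspace X - {x \<in> topspace X. f x = \<theta> x}" by blast
  ultimately show ?thesis by (metis closedin_def)
qed

text \<open>The set where \<open>f\<close> differs from \<open>\<theta>\<close> is open, so it lies
  inside the interior of its closure. Hence the support is regular closed and can be recovered from
  \<open>int_supp\<close>.\<close>

lemma closure_of_int_supp:
  assumes "Hausdorff_space H" "continuous_map X H \<theta>" "continuous_map X H f"
  shows "X closure_of int_supp X \<theta> f = supp X \<theta> f"
proof
  let ?N = "{x \<in> topspace X. f x \<noteq> \<theta> x}"
  have "?N \<subseteq> X closure_of ?N" by (rule closure_of_subset) auto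
  then have "?N \<subseteq> int_supp X \<theta> f"
    unfolding int_supp_def supp_def by (intro interior_of_maximal openin_neq[OF assms])
  then show "supp X \<theta> f \<subseteq> X closure_of int_supp X \<theta> f"
    unfolding supp_def by (rule closure_of_mono)
  show "X closure_of int_supp X \<theta> f \<subseteq> supp X \<theta> f"
    unfolding int_supp_def
    by (rule closure_of_minimal) (auto simp: interior_of_subset supp_def)
qed

text \<open>Weak regularity makes only the interior of a support small. Regularity of the space puts
  a closed \<open>C\<close> between \<open>V\<close> and \<open>U\<close>, which keeps the closure
  of that interior, the whole support, inside \<open>U\<close>.\<close>

lemma small_supp:
  assumes "locally_compact_space X" "Hausdorff_space X" "Hausdorff_space H"
    and "continuous_map X H \<theta>" "A \<subseteq> Cc X H \<theta>" "weakly_regular X \<theta> A"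
    and "openin X U" "x \<in> U"
  shows "\<exists>f\<in>A. x \<in> X interior_of supp X \<theta> f \<and> supp X \<theta> f \<subseteq> U"
proof -
  have "neighbourhood_base_of (closedin X) X"
    using assms locally_compact_Hausdorff_imp_regular_space neighbourhood_base_of_closedin by blast
  then obtain V C where V: "openin X V" "closedin X C" "x \<in> V" "V \<subseteq> C" "C \<subseteq> U"
    using assms by (metis neighbourhood_base_of)
  then have "(arbitrary union_of (\<lambda>U. U \<in> int_supp X \<theta> ` A)) V"
    using assms unfolding weakly_regular_def by simp
  then obtain f where f: "f \<in> A" "x \<in> int_supp X \<theta> f" "int_supp X \<theta> f \<subseteq> V"
    using V by (force simp: union_of_def)
  have "supp X \<theta> f = X closure_of int_supp X \<theta> f"
    using assms f by (intro closure_of_int_supp[symmetric]) (auto simp: Cc_def)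
  also have "\<dots> \<subseteq> U" using f V by (meson closure_of_minimal order_trans)
  finally show ?thesis using f by (auto simp: int_supp_def)
qed

theorem theorem1p17:
  fixes X :: "'a topology" and Y :: "'b topology"
    and HX :: "'h topology" and HY :: "'k topology"
    and \<theta>X :: "'a \<Rightarrow> 'h" and \<theta>Y :: "'b \<Rightarrow> 'k"
    and AX :: "('a \<Rightarrow> 'h) set" and AY :: "('b \<Rightarrow> 'k) set"
    and T :: "('a \<Rightarrow> 'h) \<Rightarrow> ('b \<Rightarrow> 'k)"
  assumes "locally_compact_space X" and "Hausdorff_space X"
    and "locally_compact_space Y" and "Hausdorff_space Y"
    and "Hausdorff_space HX" and "Hausdorff_space HY"
    and "continuous_map X HX \<theta>X" and "continuous_map Y HY \<theta>Y"
    and "AX \<subseteq> Cc X HX \<theta>X" and "\<theta>X \<in> AX"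
    and "AY \<subseteq> Cc Y HY \<theta>Y" and "\<theta>Y \<in> AY"
    and "weakly_regular X \<theta>X AX" and "weakly_regular Y \<theta>Y AY"
    and "sdisjoint_iso X \<theta>X AX Y \<theta>Y AY T"
  shows "(\<exists>!\<phi>. \<phi> \<in> extensional (topspace Y) \<and> homeomorphic_map Y X \<phi> \<and>
            (\<forall>f\<in>AX. \<phi> ` supp Y \<theta>Y (T f) = supp X \<theta>X f)) \<and>
         (\<forall>\<phi>. homeomorphic_map Y X \<phi> \<longrightarrow>
            ((\<forall>f\<in>AX. \<phi> ` supp Y \<theta>Y (T f) = supp X \<theta>X f) \<longleftrightarrow>
             (\<forall>f\<in>AX. \<phi> ` int_supp Y \<theta>Y (T f) = int_supp X \<theta>X f)) \<and>
            ((\<forall>f\<in>AX. \<phi> ` supp Y \<theta>Y (T f) = supp X \<theta>X f) \<longleftrightarrow>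
             (\<forall>f\<in>AX. \<phi> ` co_supp Y \<theta>Y (T f) = co_supp X \<theta>X f)))"
proof -
  have cX: "continuous_map X HX f" "compactin X (supp X \<theta>X f)" if "f \<in> AX" for f
    using assms(9) that by (auto simp: Cc_def)
  have TAY: "T f \<in> AY" if "f \<in> AX" for f
    using assms(15) that by (auto simp: sdisjoint_iso_def bij_betw_def)
  have cY: "continuous_map Y HY (T f)" "compactin Y (supp Y \<theta>Y (T f))" if "f \<in> AX" for f
    using assms(11) TAY that by (auto simp: Cc_def)
  \<comment> \<open>Indexing both families by \<open>AX\<close> turns \<open>disjoint_iff\<close>
    into the assumption on \<open>T\<close>.\<close>
  interpret support_pair X Y AX "supp X \<theta>X" "\<lambda>f. supp Y \<theta>Y (T f)"
  proof
    fix U x assume "openin X U" "x \<in> U"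
    then show "\<exists>f\<in>AX. x \<in> X interior_of supp X \<theta>X f \<and> supp X \<theta>X f \<subseteq> U"
      using small_supp[OF assms(1,2,5,7,9,13)] by blast
  next
    fix U y assume "openin Y U" "y \<in> U"
    then have "\<exists>g\<in>AY. y \<in> Y interior_of supp Y \<theta>Y g \<and> supp Y \<theta>Y g \<subseteq> U"
      using small_supp[OF assms(3,4,6,8,11,14)] by blast
    \<comment> \<open>Surjectivity of \<open>T\<close> lets the small supports in \<open>Y\<close>
      be indexed by \<open>AX\<close>.\<close>
    moreover have "T ` AX = AY" using assms(15) by (simp add: sdisjoint_iso_def bij_betw_def)
    ultimately show "\<exists>f\<in>AX. y \<in> Y interior_of supp Y \<theta>Y (T f) \<and> supp Y \<theta>Y (T f) \<subseteq> U"
      by blast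
  qed (use assms cX cY in \<open>auto simp: sdisjoint_iso_def sdisjoint_def\<close>)
  show ?thesis
  proof (rule conjI[OF ex1_homeomorphic_map], intro allI impI conjI)
    fix \<phi> assume \<phi>: "homeomorphic_map Y X \<phi>"
    \<comment> \<open>A homeomorphism commutes with interior and closure; interior leads from
      \<open>supp\<close> to \<open>int_supp\<close>, and closure leads back.\<close>
    have int_iff: "\<phi> ` supp Y \<theta>Y (T f) = supp X \<theta>X f \<longleftrightarrow>
        \<phi> ` int_supp Y \<theta>Y (T f) = int_supp X \<theta>X f" if f: "f \<in> AX" for f
    proof
      assume "\<phi> ` supp Y \<theta>Y (T f) = supp X \<theta>X f"
      then show "\<phi> ` int_supp Y \<theta>Y (T f) = int_supp X \<theta>X f"
        using homeomorphic_map_interior_of[OF \<phi> subset_topspace_Y[OF f]]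
        by (simp add: int_supp_def)
    next
      assume eq: "\<phi> ` int_supp Y \<theta>Y (T f) = int_supp X \<theta>X f"
      have "int_supp Y \<theta>Y (T f) \<subseteq> topspace Y"
        by (simp add: int_supp_def interior_of_subset_topspace)
      from homeomorphic_map_closure_of[OF \<phi> this]
      show "\<phi> ` supp Y \<theta>Y (T f) = supp X \<theta>X f"
        using eq f cX cY assms(5-8) by (simp add: closure_of_int_supp)
    qed
    then show "(\<forall>f\<in>AX. \<phi> ` supp Y \<theta>Y (T f) = supp X \<theta>X f) \<longleftrightarrow>
        (\<forall>f\<in>AX. \<phi> ` int_supp Y \<theta>Y (T f) = int_supp X \<theta>X f)" by blast
    have "\<phi> ` supp Y \<theta>Y (T f) = supp X \<theta>X f \<longleftrightarrow>
        \<phi> ` co_supp Y \<theta>Y (T f) = co_supp X \<theta>X f" if f: "f \<in> AX" for f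
    proof -
      \<comment> \<open>A bijection of the spaces carries complements to complements, and taking
        complements twice recovers the support.\<close>
      have "\<phi> ` co_supp Y \<theta>Y (T f) = topspace X - \<phi> ` supp Y \<theta>Y (T f)"
        unfolding co_supp_def
        using homeomorphic_imp_surjective_map[OF \<phi>] homeomorphic_imp_injective_map[OF \<phi>]
          subset_topspace_Y[OF f] by (metis Diff_subset inj_on_image_set_diff)
      moreover have "\<phi> ` supp Y \<theta>Y (T f) \<subseteq> topspace X"
        using homeomorphic_imp_surjective_map[OF \<phi>] subset_topspace_Y[OF f] by blast
      ultimately show ?thesis
        using subset_topspace_X[OF f] unfolding co_supp_def[of X] by (metis double_diff order_refl)
    qed
    then show "(\<forall>f\<in>AX. \<phi> ` supp Y \<theta>Y (T f) = supp X \<theta>X f) \<longleftrightarrow>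
        (\<forall>f\<in>AX. \<phi> ` co_supp Y \<theta>Y (T f) = co_supp X \<theta>X f)" by blast
  qed
qed

end
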